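(* Let $n\ge 1$ be an integer. For every integer $T\ge 0$ there exists a rectilinear polygon $C$ with $T$ reflex vertices in which it is impossible to guarantee every agent a rectangle with value more than $1/(n+T)$ of the total polygon value; that is, there exist value-measures $V_1,\dots,V_n$ on $C$ with $V_i(C)>0$ for all $i$, such that for every $n$ pairwise interior-disjoint rectangles $Z_1,\dots,Z_n\subseteq C$ there is some $i\in\{1,\dots,n\}$ with $V_i(Z_i)\le \frac{1}{n+T}V_i(C)$.
   Context: A rectilinear polygon is a polygon in the plane (including its interior) all of whose internal angles are $90^\circ$ or $270^\circ$. A reflex vertex is a vertex with internal angle $270^\circ$. A value-measure on $C$ is a function of the form $V(Z)=\int_Z v(x)\,dx$ for (measurable) $Z\subseteq C$, where $v:C\to\mathbb{R}_{\ge0}$ is integrable with respect to the two-dimensional Lebesgue measure. *)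

theory Defs
  imports "HOL-Analysis.Analysis"
begin

type_synonym plane = "real \<times> real"

fun polygonal_chain :: "plane list \<Rightarrow> real \<Rightarrow> plane" where
  "polygonal_chain [] = linepath 0 0"
| "polygonal_chain [a] = linepath a a"
| "polygonal_chain [a, b] = linepath a b"
| "polygonal_chain (a # b # c # ps) = linepath a b +++ polygonal_chain (b # c # ps)"

definition polygon_boundary :: "plane list \<Rightarrow> plane set" where
  "polygon_boundary ps = path_image (polygonal_chain (ps @ [hd ps]))"

text \<open>
  \<open>polygon ps C\<close>: the region \<open>C\<close> (boundary included) is enclosed by the simple closed
  polygonal chain through the vertices \<open>ps\<close>, listed in cyclic order in either orientation and
  without repeating the first vertex at the end. Polygons have no holes.
\<close>

definition polygon :: "plane list \<Rightarrow> plane set \<Rightarrow> bool" where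
  "polygon ps C \<longleftrightarrow> length ps \<ge> 3 \<and> simple_path (polygonal_chain (ps @ [hd ps])) \<and>
     C = polygon_boundary ps \<union> inside (polygon_boundary ps)"

text \<open>
  The internal angle, in radians, is the angular measure of the directions that point from \<open>p\<close>
  into \<open>C\<close>. The two edge directions belong to this set but do not affect its measure.
\<close>

definition internal_angle :: "plane set \<Rightarrow> plane \<Rightarrow> real" where
  "internal_angle C p =
     measure lebesgue {\<theta> \<in> {0..<2 * pi}. \<forall>\<^sub>F t in at_right 0. p + t *\<^sub>R (cos \<theta>, sin \<theta>) \<in> C}"

definition rectilinear_polygon :: "plane list \<Rightarrow> plane set \<Rightarrow> bool" where
  "rectilinear_polygon ps C \<longleftrightarrow>
     polygon ps C \<and> (\<forall>p\<in>set ps. internal_angle C p = pi / 2 \<or> internal_angle C p = 3 * pi / 2)"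

definition reflex_vertices :: "plane list \<Rightarrow> plane set \<Rightarrow> plane set" where
  "reflex_vertices ps C = {p \<in> set ps. internal_angle C p = 3 * pi / 2}"

text \<open>Rectangles are closed and non-degenerate; their sides need not be parallel to the axes.\<close>

definition rectangle :: "plane set \<Rightarrow> bool" where
  "rectangle R \<longleftrightarrow> (\<exists>p u w. u \<noteq> 0 \<and> w \<noteq> 0 \<and> u \<bullet> w = 0 \<and>
     R = {p + s *\<^sub>R u + t *\<^sub>R w | s t. s \<in> {0..1} \<and> t \<in> {0..1}})"

definition value_measure_on :: "plane set \<Rightarrow> (plane set \<Rightarrow> real) \<Rightarrow> bool" where
  "value_measure_on C V \<longleftrightarrow> (\<exists>v :: plane \<Rightarrow> real.
     (\<forall>x\<in>C. 0 \<le> v x) \<and> set_integrable lebesgue C v \<and>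
     (\<forall>Z\<in>sets lebesgue. Z \<subseteq> C \<longrightarrow> V Z = (LINT x:Z|lebesgue. v x)))"

end

theory Submission
  imports Defs
begin

text \<open>
  The polygon is a staircase with \<open>T + 1\<close> steps: the union of the rectangles
  \<open>[0, k + 1] \<times> [0, T + 1 - k]\<close> for \<open>k \<le> T\<close>. It has one convex corner at the top of each step and
  one reflex corner between any two neighbouring steps.

  All agents share the same value-measure. It is concentrated, with piecewise constant density, on
  small congruent squares, the pools, one in the outer corner of each step. The first pool is worth
  \<open>n\<close> and each of the other \<open>T\<close> pools is worth \<open>1\<close>, so the total value is \<open>n + T\<close>. A segment between
  two pools passes above a reflex corner and leaves the staircase; hence a convex subset of the
  staircase, in particular a rectangle in any direction, meets at most one pool
  (\<open>convex_subset_staircase_one_pool\<close>). If every agent received more than \<open>1\<close>, then every agent's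
  rectangle would have to take its value from the first pool. The \<open>n\<close> rectangles would then share
  value \<open>n\<close> and could not all exceed \<open>1\<close> (\<open>exists_agent_with_at_most_one_pool\<close>).

  Most of the work is to confirm that the staircase is a polygon in the formal sense. The boundary
  chain is treated by recursion on the number of remaining steps, which gives both its path image
  and its simplicity. To identify the enclosed region, the Jordan curve theorem is avoided: the
  complement of the staircase is connected and unbounded, hence outside the chain, while the
  frontier of the staircase lies on the chain, so that nothing in the staircase is outside
  (\<open>polygon_staircase\<close>). Internal angles are read off from the cone that coincides with the
  staircase near a vertex.
\<close>

section \<open>Polygonal chains\<close>

lemma pathstart_polygonal_chain: "xs \<noteq> [] \<Longrightarrow> pathstart (polygonal_chain xs) = hd xs"
  by (induction xs rule: polygonal_chain.induct) auto

lemma pathfinish_polygonal_chain: "xs \<noteq> [] \<Longrightarrow> pathfinish (polygonal_chain xs) = last xs"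
  by (induction xs rule: polygonal_chain.induct) auto

lemma polygonal_chain_Cons:
  "length xs \<ge> 2 \<Longrightarrow> polygonal_chain (a # xs) = linepath a (hd xs) +++ polygonal_chain xs"
  by (cases xs rule: polygonal_chain.cases) auto

lemma closed_segment_horizontal:
  fixes a b c :: real
  assumes "a \<le> b"
  shows "closed_segment (a, c) (b, c) = {a..b} \<times> {c}"
    and "closed_segment (b, c) (a, c) = {a..b} \<times> {c}"
proof -
  show "closed_segment (a, c) (b, c) = {a..b} \<times> {c}"
  proof -
    have "closed_segment (a, c) (b, c) = (\<lambda>x. (x, c)) ` closed_segment a b"
      by (force simp: closed_segment_def image_iff algebra_simps)
    then show ?thesis
      using assms by (auto simp: closed_segment_eq_real_ivl)
  qed
  then show "closed_segment (b, c) (a, c) = {a..b} \<times> {c}"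
    by (simp add: closed_segment_commute)
qed

lemma closed_segment_vertical:
  fixes a b c :: real
  assumes "a \<le> b"
  shows "closed_segment (c, a) (c, b) = {c} \<times> {a..b}"
    and "closed_segment (c, b) (c, a) = {c} \<times> {a..b}"
proof -
  show "closed_segment (c, a) (c, b) = {c} \<times> {a..b}"
  proof -
    have "closed_segment (c, a) (c, b) = (\<lambda>x. (c, x)) ` closed_segment a b"
      by (force simp: closed_segment_def image_iff algebra_simps)
    then show ?thesis
      using assms by (auto simp: closed_segment_eq_real_ivl)
  qed
  then show "closed_segment (c, b) (c, a) = {c} \<times> {a..b}"
    by (simp add: closed_segment_commute)
qed

section \<open>The staircase polygon\<close>

text \<open>
  The corners met when walking down \<open>r\<close> unit steps from \<open>(a, r)\<close> to the axis at \<open>(a + r, 0)\<close>. The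
  abscissa \<open>a\<close> is a parameter because removing the first step shifts the rest of the walk by one.
\<close>

fun descent :: "real \<Rightarrow> nat \<Rightarrow> plane list" where
  "descent a 0 = [(a, 0)]"
| "descent a (Suc r) = (a, real r + 1) # (a + 1, real r + 1) # descent (a + 1) r"

definition staircase_vertices :: "nat \<Rightarrow> plane list" where
  "staircase_vertices T = (0, 0) # descent 0 (Suc T)"

definition staircase :: "nat \<Rightarrow> plane set" where
  "staircase T = (\<Union>k\<le>T. cbox (0, 0) (real k + 1, real T + 1 - real k))"

lemma mem_staircase:
  "(x, y) \<in> staircase T \<longleftrightarrow>
     0 \<le> x \<and> 0 \<le> y \<and> (\<exists>k\<le>T. x \<le> real k + 1 \<and> y \<le> real T + 1 - real k)"
  by (auto simp: staircase_def cbox_Pair_eq)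

lemma compact_staircase: "compact (staircase T)"
  unfolding staircase_def by (intro compact_UN) auto

lemma descent_not_Nil [simp]: "descent a r \<noteq> []"
  by (cases r) auto

lemma hd_descent [simp]: "hd (descent a r) = (a, real r)"
  by (cases r) auto

lemma descent_length: "length (descent a r) \<ge> 1"
  by (cases r) auto

lemma set_descent:
  "set (descent a r) =
     {(a, real r), (a + real r, 0)} \<union>
     (\<lambda>k. (a + real k + 1, real r - real k)) ` {..<r} \<union>
     (\<lambda>k. (a + real k + 1, real r - real k - 1)) ` {..<r}"
proof (induction r arbitrary: a)
  case (Suc r)
  show ?case
    unfolding descent.simps list.set Suc.IH lessThan_Suc_eq_insert_0 image_insert image_image
    by (auto simp: algebra_simps)
qed auto

lemma polygonal_chain_descent_Suc:
  "polygonal_chain (descent a (Suc r) @ [0]) =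
     linepath (a, real r + 1) (a + 1, real r + 1) +++
     linepath (a + 1, real r + 1) (a + 1, real r) +++ polygonal_chain (descent (a + 1) r @ [0])"
  using descent_length[of "a + 1" r]
  by (simp add: polygonal_chain_Cons del: polygonal_chain.simps)

text \<open>
  The chain is closed off by the edge that returns from \<open>(a + r, 0)\<close> to the origin; keeping that edge
  in the induction makes the formula valid for the whole boundary except its left side.
\<close>

lemma path_image_descent:
  assumes "a \<ge> 0"
  shows "path_image (polygonal_chain (descent a r @ [0])) =
    {0..a + real r} \<times> {0} \<union>
    (\<Union>k<r. {a + real k..a + real k + 1} \<times> {real r - real k} \<union>
           {a + real k + 1} \<times> {real r - real k - 1..real r - real k})"
  using assms
proof (induction r arbitrary: a)
  case 0
  then show ?case
    using closed_segment_horizontal(2)[of 0 a 0] by (simp add: zero_prod_def)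
next
  case (Suc r)
  have ps: "pathstart (polygonal_chain (descent (a + 1) r @ [0])) = (a + 1, real r)"
    by (simp add: pathstart_polygonal_chain)
  have "path_image (polygonal_chain (descent a (Suc r) @ [0])) =
      {a..a + 1} \<times> {real r + 1} \<union> ({a + 1} \<times> {real r..real r + 1} \<union>
      path_image (polygonal_chain (descent (a + 1) r @ [0])))"
    unfolding polygonal_chain_descent_Suc
    by (simp add: path_image_join ps closed_segment_horizontal closed_segment_vertical)
  also have "\<dots> = {0..a + real (Suc r)} \<times> {0} \<union>
    (\<Union>k<Suc r. {a + real k..a + real k + 1} \<times> {real (Suc r) - real k} \<union>
           {a + real k + 1} \<times> {real (Suc r) - real k - 1..real (Suc r) - real k})"
    using Suc.prems
    by (subst Suc.IH) (auto simp: lessThan_Suc_eq_insert_0 image_image algebra_simps)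
  finally show ?case .
qed

lemma descent_height:
  assumes "a \<ge> 0" "(x, y) \<in> path_image (polygonal_chain (descent a r @ [0]))"
  shows "y \<le> real r"
  using assms(2) unfolding path_image_descent[OF assms(1)] by auto

text \<open>
  Every step is strictly above what follows it, so the horizontal edge, the vertical edge and the
  remaining chain meet only at their joints. If \<open>a = r = 0\<close>, the chain is a single point
  and not an arc.
\<close>

lemma arc_descent:
  assumes "a \<ge> 0" "a > 0 \<or> r > 0"
  shows "arc (polygonal_chain (descent a r @ [0]))"
  using assms
proof (induction r arbitrary: a)
  case 0
  then show ?case by (auto simp: zero_prod_def)
next
  case (Suc r)
  let ?g = "polygonal_chain (descent (a + 1) r @ [0])"
  have ps: "pathstart ?g = (a + 1, real r)"
    by (simp add: pathstart_polygonal_chain)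
  have arc_g: "arc ?g" using Suc by simp
  have low: "y \<le> real r" if "(x, y) \<in> path_image ?g" for x y
    using descent_height[of "a + 1" x y r] that Suc.prems by simp
  have arc_drop: "arc (linepath (a + 1, real r + 1) (a + 1, real r) +++ ?g)"
    by (rule arc_join) (use arc_g ps in \<open>auto simp: closed_segment_vertical dest!: low\<close>)
  show ?case
    unfolding polygonal_chain_descent_Suc
  proof (rule arc_join[OF _ arc_drop])
    show "path_image (linepath (a, real r + 1) (a + 1, real r + 1)) \<inter>
        path_image (linepath (a + 1, real r + 1) (a + 1, real r) +++ ?g)
        \<subseteq> {pathstart (linepath (a + 1, real r + 1) (a + 1, real r) +++ ?g)}"
      by (auto simp: path_image_join ps closed_segment_horizontal closed_segment_vertical dest!: low)
  qed auto
qed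

lemma staircase_chain:
  "polygonal_chain (staircase_vertices T @ [hd (staircase_vertices T)]) =
     linepath 0 (0, real T + 1) +++ polygonal_chain (descent 0 (Suc T) @ [0])"
  using descent_length[of 0 "Suc T"]
  by (simp add: staircase_vertices_def polygonal_chain_Cons zero_prod_def
      del: polygonal_chain.simps)

lemma simple_path_staircase:
  "simple_path (polygonal_chain (staircase_vertices T @ [hd (staircase_vertices T)]))"
proof -
  let ?h = "polygonal_chain (descent 0 (Suc T) @ [0])"
  have ends: "pathstart ?h = (0, real T + 1)" "pathfinish ?h = 0"
    by (subst pathstart_polygonal_chain pathfinish_polygonal_chain; simp)+
  have "path_image (linepath 0 (0, real T + 1)) \<inter> path_image ?h \<subseteq> {(0, real T + 1), 0}"
    unfolding path_image_descent[OF order_refl]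
    by (auto simp: zero_prod_def closed_segment_vertical)
  moreover have "arc ?h"
    by (rule arc_descent) auto
  ultimately show ?thesis
    unfolding staircase_chain
    by (intro simple_path_join_loop) (simp_all only: ends, auto simp: zero_prod_def)
qed

lemma polygon_boundary_staircase:
  "polygon_boundary (staircase_vertices T) =
    {0} \<times> {0..real T + 1} \<union> {0..real T + 1} \<times> {0} \<union>
    (\<Union>k\<le>T. {real k..real k + 1} \<times> {real T + 1 - real k} \<union>
           {real k + 1} \<times> {real T - real k..real T + 1 - real k})"
proof -
  let ?h = "polygonal_chain (descent 0 (Suc T) @ [0])"
  have "pathstart ?h = (0, real T + 1)"
    by (simp add: pathstart_polygonal_chain)
  then have "polygon_boundary (staircase_vertices T) =
      {0} \<times> {0..real T + 1} \<union> path_image ?h"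
    unfolding polygon_boundary_def staircase_chain zero_prod_def
    by (simp add: path_image_join closed_segment_vertical del: polygonal_chain.simps)
  then show ?thesis
    unfolding path_image_descent[OF order_refl] by (auto simp: lessThan_Suc_atMost algebra_simps)
qed

text \<open>
  A point of the staircase on a grid line between two steps is in the interior of a neighbouring
  rectangle, unless it is on the boundary chain. So the open rectangles together cover everything
  off the chain.
\<close>

lemma staircase_minus_boundary:
  assumes "(x, y) \<in> staircase T" "(x, y) \<notin> polygon_boundary (staircase_vertices T)"
  shows "\<exists>k\<le>T. 0 < x \<and> 0 < y \<and> x < real k + 1 \<and> y < real T + 1 - real k"
proof -
  obtain j where j: "j \<le> T" "x \<le> real j + 1" "y \<le> real T + 1 - real j"
    and nonneg: "0 \<le> x" "0 \<le> y"
    using assms(1) by (auto simp: mem_staircase)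
  have pos: "0 < x" "0 < y"
    using assms(2) j nonneg by (auto simp: polygon_boundary_staircase)
  \<comment> \<open>\<open>k\<close> is the column \<open>k < x \<le> k + 1\<close> that contains the point.\<close>
  define k where "k = nat (\<lceil>x\<rceil> - 1)"
  have k: "real k < x" "x \<le> real k + 1"
    using pos by (auto simp: k_def) linarith+
  have "k \<le> j"
    using k(1) j(2) by linarith
  then have yk: "y \<le> real T + 1 - real k" "k \<le> T"
    using j by auto
  have off: "\<not> (k \<le> T \<and> real k \<le> x \<and> x \<le> real k + 1 \<and> y = real T + 1 - real k)"
    "\<not> (k \<le> T \<and> x = real k + 1 \<and> real T - real k \<le> y \<and> y \<le> real T + 1 - real k)"
    using assms(2) by (auto simp: polygon_boundary_staircase)
  show ?thesis
  proof (cases "x = real k + 1")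
    case True
    then have "y < real T - real k"
      using off yk by auto
    moreover from this have "Suc k \<le> T"
      using pos by linarith
    ultimately show ?thesis
      using True pos by (intro exI[of _ "Suc k"]) auto
  next
    case False
    then show ?thesis
      using off k yk pos by (intro exI[of _ k]) auto
  qed
qed

lemma frontier_staircase_subset:
  "frontier (staircase T) \<subseteq> polygon_boundary (staircase_vertices T)"
proof -
  define U where "U = (\<Union>k\<le>T. {0<..<real k + 1} \<times> {0<..<real T + 1 - real k})"
  have "U \<subseteq> staircase T"
    by (fastforce simp: U_def mem_staircase)
  moreover have "open U"
    unfolding U_def by (intro open_UN ballI open_Times) auto
  ultimately have "U \<subseteq> interior (staircase T)"
    by (simp add: interior_maximal)
  moreover have "staircase T \<subseteq> U \<union> polygon_boundary (staircase_vertices T)"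
  proof clarify
    fix x y assume "(x, y) \<in> staircase T" "(x, y) \<notin> polygon_boundary (staircase_vertices T)"
    from staircase_minus_boundary[OF this] show "(x, y) \<in> U"
      by (auto simp: U_def)
  qed
  ultimately show ?thesis
    using compact_staircase[of T] by (auto simp: frontier_def compact_imp_closed closure_closed)
qed

lemma boundary_subset_staircase:
  "polygon_boundary (staircase_vertices T) \<subseteq> staircase T"
proof clarify
  fix x y assume "(x, y) \<in> polygon_boundary (staircase_vertices T)"
  then consider "x = 0" "0 \<le> y" "y \<le> real T + 1" | "y = 0" "0 \<le> x" "x \<le> real T + 1"
    | k where "k \<le> T" "real k \<le> x" "x \<le> real k + 1"
        "real T - real k \<le> y" "y \<le> real T + 1 - real k"
    unfolding polygon_boundary_staircase by auto
  then show "(x, y) \<in> staircase T"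
  proof cases
    case 1
    then show ?thesis by (auto simp: mem_staircase intro!: exI[of _ 0])
  next
    case 2
    then show ?thesis by (auto simp: mem_staircase intro!: exI[of _ T])
  next
    case (3 k)
    then show ?thesis by (auto simp: mem_staircase intro!: exI[of _ k])
  qed
qed

text \<open>
  The half-planes to the left of, below and above the staircase are convex, and the first one meets
  the other two. Every other point of the complement reaches the upper half-plane by a vertical ray
  because the staircase has no points above a missing one in the first quadrant.
\<close>

lemma connected_compl_staircase: "connected (- staircase T)"
proof -
  let ?b = "(-1, real T + 2) :: plane"
  let ?conn = "connected_component (- staircase T)"
  have seg: "?conn p q" if "convex K" "p \<in> K" "q \<in> K" "K \<subseteq> - staircase T" for p q K
    using that convex_connected connected_component_def by blast
  have left: "?conn p ?b" if "fst p < 0" for p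
  proof (rule seg)
    show "convex ({..<0} \<times> UNIV :: plane set)" by (intro convex_Times) auto
  qed (use that in \<open>auto simp: mem_staircase mem_Times_iff\<close>)
  have below: "?conn p ?b" if "snd p < 0" for p
  proof -
    have "?conn p (-1, snd p)"
    proof (rule seg)
      show "convex (UNIV \<times> {..<0} :: plane set)" by (intro convex_Times) auto
    qed (use that in \<open>auto simp: mem_staircase mem_Times_iff\<close>)
    then show ?thesis
      using left[of "(-1, snd p)"] connected_component_trans by fastforce
  qed
  have above: "?conn p ?b" if "snd p > real T + 1" for p
  proof (rule seg)
    show "convex (UNIV \<times> {real T + 1<..} :: plane set)" by (intro convex_Times) auto
  qed (use that in \<open>auto simp: mem_staircase mem_Times_iff\<close>)
  have "?conn p ?b" if p: "p \<in> - staircase T" for p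
  proof (cases "fst p < 0 \<or> snd p < 0")
    case False
    have "?conn p (fst p, max (snd p) (real T + 2))"
    proof (rule seg)
      show "convex ({fst p} \<times> {snd p..} :: plane set)" by (intro convex_Times) auto
      show "{fst p} \<times> {snd p..} \<subseteq> - staircase T"
        using p False by (cases p) (force simp: mem_staircase)
    qed (auto simp: mem_Times_iff)
    moreover have "?conn (fst p, max (snd p) (real T + 2)) ?b"
      by (rule above) auto
    ultimately show ?thesis
      by (rule connected_component_trans)
  qed (use left[of p] below[of p] in blast)
  then show ?thesis
    unfolding connected_iff_connected_component
    using connected_component_trans connected_component_sym by blast
qed

text \<open>
  Since \<open>outside\<close> is antitone, it is enough to compare the chain with the frontier of the staircase
  from one side. The connected unbounded complement gives the other inclusion.
\<close>

lemma polygon_staircase: "polygon (staircase_vertices T) (staircase T)"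
proof -
  let ?B = "polygon_boundary (staircase_vertices T)"
  have bnd: "bounded (staircase T)" and cl: "closed (staircase T)"
    using compact_staircase by (auto simp: compact_eq_bounded_closed)
  have "outside ?B \<subseteq> outside (frontier (staircase T))"
    by (rule outside_mono[OF frontier_staircase_subset])
  also have "\<dots> \<subseteq> - staircase T"
    using outside_frontier_misses_closure[OF bnd] closure_subset by blast
  finally have "outside ?B \<subseteq> - staircase T" .
  moreover have "p \<in> outside ?B" if p: "p \<in> - staircase T" for p
  proof -
    have "- staircase T \<subseteq> connected_component_set (- ?B) p"
      using p connected_compl_staircase boundary_subset_staircase
      by (intro connected_component_maximal) auto
    moreover have "\<not> bounded (- staircase T)"
      using bnd by (rule cobounded_imp_unbounded[of "- staircase T", simplified])
    ultimately have "\<not> bounded (connected_component_set (- ?B) p)"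
      using bounded_subset by blast
    then show ?thesis
      using p boundary_subset_staircase by (auto simp: outside_def)
  qed
  ultimately have "outside ?B = - staircase T" by blast
  moreover have "?B \<union> inside ?B = - outside ?B"
    using union_with_inside by blast
  moreover have "length (staircase_vertices T) \<ge> 3"
    using descent_length[of 1 T] by (simp add: staircase_vertices_def)
  ultimately show ?thesis
    unfolding polygon_def using simple_path_staircase by simp
qed

section \<open>Internal angles\<close>

text \<open>
  Near a vertex a polygon agrees with a cone, here given by the predicate \<open>P\<close> on displacements. Short
  initial pieces of a ray then lie in the polygon exactly if its direction lies in the cone. The
  bound \<open>1\<close> on the displacements is the length of the shortest edge of the staircase.
\<close>

lemma internal_angle_local_cone:
  assumes local: "\<And>x y. \<bar>x\<bar> < 1 \<Longrightarrow> \<bar>y\<bar> < 1 \<Longrightarrow> p + (x, y) \<in> C \<longleftrightarrow> P x y"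
    and cone: "\<And>t x y. t > 0 \<Longrightarrow> P (t * x) (t * y) \<longleftrightarrow> P x y"
  shows "internal_angle C p = measure lebesgue {\<theta> \<in> {0..<2 * pi}. P (cos \<theta>) (sin \<theta>)}"
proof -
  have "(\<forall>\<^sub>F t in at_right 0. p + t *\<^sub>R (cos \<theta>, sin \<theta>) \<in> C) \<longleftrightarrow> P (cos \<theta>) (sin \<theta>)" for \<theta>
  proof -
    have "\<forall>\<^sub>F t::real in at_right 0. t \<in> {0<..<1}"
      by (intro eventually_at_right_real) simp
    then have "\<forall>\<^sub>F t in at_right 0.
        p + t *\<^sub>R (cos \<theta>, sin \<theta>) \<in> C \<longleftrightarrow> P (cos \<theta>) (sin \<theta>)"
    proof eventually_elim
      fix t :: real assume "t \<in> {0<..<1}"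
      then have t: "0 < t" "t < 1" by auto
      then have "t * \<bar>cos \<theta>\<bar> \<le> t * 1" "t * \<bar>sin \<theta>\<bar> \<le> t * 1"
        by (intro mult_left_mono; simp)+
      then have "t * \<bar>cos \<theta>\<bar> < 1" "t * \<bar>sin \<theta>\<bar> < 1"
        using t by linarith+
      then have "\<bar>t * cos \<theta>\<bar> < 1" "\<bar>t * sin \<theta>\<bar> < 1"
        using t by (simp_all add: abs_mult)
      then show "p + t *\<^sub>R (cos \<theta>, sin \<theta>) \<in> C \<longleftrightarrow> P (cos \<theta>) (sin \<theta>)"
        using local[of "t * cos \<theta>" "t * sin \<theta>"] cone[of t] t by simp
    qed
    then have "(\<forall>\<^sub>F t in at_right 0. p + t *\<^sub>R (cos \<theta>, sin \<theta>) \<in> C) \<longleftrightarrow>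
        (\<forall>\<^sub>F t::real in at_right 0. P (cos \<theta>) (sin \<theta>))"
      by (rule eventually_subst)
    then show ?thesis by simp
  qed
  then show ?thesis
    by (simp add: internal_angle_def)
qed

lemma sin_sign:
  assumes "0 \<le> \<theta>" "\<theta> < 2 * pi"
  shows "0 \<le> sin \<theta> \<longleftrightarrow> \<theta> \<le> pi" and "sin \<theta> \<le> 0 \<longleftrightarrow> \<theta> = 0 \<or> pi \<le> \<theta>"
proof -
  have "\<theta> \<le> pi \<Longrightarrow> 0 \<le> sin \<theta>" "pi < \<theta> \<Longrightarrow> sin \<theta> < 0" "0 < \<theta> \<and> \<theta> < pi \<Longrightarrow> 0 < sin \<theta>"
    using assms by (auto intro: sin_ge_zero sin_lt_zero sin_gt_zero)
  moreover have "\<theta> = pi \<Longrightarrow> sin \<theta> = 0" "\<theta> = 0 \<Longrightarrow> sin \<theta> = 0" by auto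
  ultimately show "0 \<le> sin \<theta> \<longleftrightarrow> \<theta> \<le> pi" and "sin \<theta> \<le> 0 \<longleftrightarrow> \<theta> = 0 \<or> pi \<le> \<theta>"
    using assms by (smt (verit))+
qed

lemma cos_sign:
  assumes "0 \<le> \<theta>" "\<theta> < 2 * pi"
  shows "0 \<le> cos \<theta> \<longleftrightarrow> \<theta> \<le> pi / 2 \<or> 3 * pi / 2 \<le> \<theta>"
    and "cos \<theta> \<le> 0 \<longleftrightarrow> pi / 2 \<le> \<theta> \<and> \<theta> \<le> 3 * pi / 2"
proof -
  have "\<theta> < pi / 2 \<Longrightarrow> 0 < cos \<theta>"
    using assms by (intro cos_gt_zero_pi) auto
  moreover have "cos \<theta> < 0" if "pi / 2 < \<theta>" "\<theta> < 3 * pi / 2"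
    using that cos_gt_zero_pi[of "\<theta> - pi"] by (simp add: cos_diff)
  moreover have "0 < cos \<theta>" if "3 * pi / 2 < \<theta>"
    using that assms cos_gt_zero_pi[of "\<theta> - 2 * pi"] by (simp add: cos_diff)
  moreover have "\<theta> = pi / 2 \<Longrightarrow> cos \<theta> = 0" "\<theta> = 3 * pi / 2 \<Longrightarrow> cos \<theta> = 0"
    using cos_pi_half cos_3over2_pi by (simp_all only: mult.commute times_divide_eq_left times_divide_eq_right)
  ultimately show "0 \<le> cos \<theta> \<longleftrightarrow> \<theta> \<le> pi / 2 \<or> 3 * pi / 2 \<le> \<theta>"
    and "cos \<theta> \<le> 0 \<longleftrightarrow> pi / 2 \<le> \<theta> \<and> \<theta> \<le> 3 * pi / 2"
    using assms by (smt (verit))+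
qed

lemma measure_eq_interval_if_finite_symdiff:
  fixes a b :: real
  assumes "a \<le> b" "A - F = {a..b} - F" "finite F"
  shows "measure lebesgue A = b - a"
proof -
  have "sym_diff {a..b} A \<subseteq> F" using assms(2) by blast
  then have "negligible (sym_diff {a..b} A)"
    using assms(3) negligible_finite finite_subset by blast
  then have "measure lebesgue A = measure lebesgue {a..b}"
    by (rule measure_negligible_symdiff[rotated]) auto
  then show ?thesis using assms(1) by simp
qed

text \<open>
  Each set of directions is an interval up to finitely many multiples of \<open>pi / 2\<close>, where a sine or
  cosine vanishes. The last set is the complement of an open quadrant, as at a reflex vertex.
\<close>

lemma quadrant_measures:
  shows "measure lebesgue {\<theta> \<in> {0..<2 * pi}. 0 \<le> cos \<theta> \<and> 0 \<le> sin \<theta>} = pi / 2"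
    and "measure lebesgue {\<theta> \<in> {0..<2 * pi}. cos \<theta> \<le> 0 \<and> 0 \<le> sin \<theta>} = pi / 2"
    and "measure lebesgue {\<theta> \<in> {0..<2 * pi}. cos \<theta> \<le> 0 \<and> sin \<theta> \<le> 0} = pi / 2"
    and "measure lebesgue {\<theta> \<in> {0..<2 * pi}. 0 \<le> cos \<theta> \<and> sin \<theta> \<le> 0} = pi / 2"
    and "measure lebesgue {\<theta> \<in> {0..<2 * pi}. cos \<theta> \<le> 0 \<or> sin \<theta> \<le> 0} = 3 * pi / 2"
proof -
  define F where "F = {0, pi / 2, pi, 3 * pi / 2, 2 * pi}"
  note signs = sin_sign cos_sign F_def
  have "measure lebesgue {\<theta> \<in> {0..<2 * pi}. 0 \<le> cos \<theta> \<and> 0 \<le> sin \<theta>} = pi / 2 - 0"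
    by (rule measure_eq_interval_if_finite_symdiff[where F = F]) (auto simp: signs)
  then show "measure lebesgue {\<theta> \<in> {0..<2 * pi}. 0 \<le> cos \<theta> \<and> 0 \<le> sin \<theta>} = pi / 2" by simp
  have "measure lebesgue {\<theta> \<in> {0..<2 * pi}. cos \<theta> \<le> 0 \<and> 0 \<le> sin \<theta>} = pi - pi / 2"
    by (rule measure_eq_interval_if_finite_symdiff[where F = F]) (auto simp: signs)
  then show "measure lebesgue {\<theta> \<in> {0..<2 * pi}. cos \<theta> \<le> 0 \<and> 0 \<le> sin \<theta>} = pi / 2" by simp
  have "measure lebesgue {\<theta> \<in> {0..<2 * pi}. cos \<theta> \<le> 0 \<and> sin \<theta> \<le> 0} = 3 * pi / 2 - pi"
    by (rule measure_eq_interval_if_finite_symdiff[where F = F]) (auto simp: signs)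
  then show "measure lebesgue {\<theta> \<in> {0..<2 * pi}. cos \<theta> \<le> 0 \<and> sin \<theta> \<le> 0} = pi / 2" by simp
  have "measure lebesgue {\<theta> \<in> {0..<2 * pi}. 0 \<le> cos \<theta> \<and> sin \<theta> \<le> 0} = 2 * pi - 3 * pi / 2"
    by (rule measure_eq_interval_if_finite_symdiff[where F = F]) (auto simp: signs)
  then show "measure lebesgue {\<theta> \<in> {0..<2 * pi}. 0 \<le> cos \<theta> \<and> sin \<theta> \<le> 0} = pi / 2" by simp
  have "measure lebesgue {\<theta> \<in> {0..<2 * pi}. cos \<theta> \<le> 0 \<or> sin \<theta> \<le> 0} = 2 * pi - pi / 2"
    by (rule measure_eq_interval_if_finite_symdiff[where F = F]) (auto simp: signs)
  then show "measure lebesgue {\<theta> \<in> {0..<2 * pi}. cos \<theta> \<le> 0 \<or> sin \<theta> \<le> 0} = 3 * pi / 2" by simp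
qed

section \<open>Fair division among weighted pools\<close>

lemma convex_rectangle:
  assumes "rectangle R"
  shows "convex R"
proof -
  obtain p u w where
    R: "R = {p + s *\<^sub>R u + t *\<^sub>R w | s t. s \<in> {0..1} \<and> t \<in> {0..1::real}}"
    using assms by (auto simp: rectangle_def)
  let ?L = "\<lambda>z. fst z *\<^sub>R u + snd z *\<^sub>R w"
  have "R = (\<lambda>x. p + x) ` ?L ` ({0..1} \<times> {0..1})"
  proof (intro subset_antisym subsetI)
    fix x assume "x \<in> R"
    then obtain s t where "s \<in> {0..1}" "t \<in> {0..1}" "x = p + s *\<^sub>R u + t *\<^sub>R w"
      unfolding R by blast
    then show "x \<in> (\<lambda>x. p + x) ` ?L ` ({0..1} \<times> {0..1})"
      by (intro image_eqI[of _ _ "?L (s, t)"] image_eqI[of _ _ "(s, t)"]) (auto simp: add.assoc)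
  next
    fix x assume "x \<in> (\<lambda>x. p + x) ` ?L ` ({0..1} \<times> {0..1})"
    then obtain z where "z \<in> {0..1} \<times> {0..1}" "x = p + ?L z" by blast
    then have "x = p + fst z *\<^sub>R u + snd z *\<^sub>R w" "fst z \<in> {0..1}" "snd z \<in> {0..1}"
      by (auto simp: add.assoc)
    then show "x \<in> R" unfolding R by blast
  qed
  moreover have "linear ?L"
    by (rule linearI) (auto simp: algebra_simps)
  ultimately show ?thesis
    by (simp add: convex_translation convex_linear_image convex_Times)
qed

text \<open>
  The value-measure whose density is \<open>w j\<close> on the pool \<open>P j\<close>, where densities add on overlaps.
\<close>

definition pooled_value :: "(nat \<Rightarrow> plane set) \<Rightarrow> (nat \<Rightarrow> real) \<Rightarrow> nat \<Rightarrow> plane set \<Rightarrow> real" where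
  "pooled_value P w T Z = (\<Sum>j\<le>T. w j * measure lebesgue (Z \<inter> P j))"

lemma value_measure_pooled_value:
  assumes P: "\<And>j. j \<le> T \<Longrightarrow> P j \<in> lmeasurable" and w: "\<And>j. j \<le> T \<Longrightarrow> 0 \<le> w j"
    and C: "C \<in> sets lebesgue"
  shows "value_measure_on C (pooled_value P w T)"
proof -
  let ?v = "\<lambda>x. \<Sum>j\<le>T. w j * indicat_real (P j) x"
  have meas: "Z \<inter> P j \<in> lmeasurable" if "Z \<in> sets lebesgue" "j \<le> T" for Z j
    using fmeasurable_Int_fmeasurable[OF P[OF that(2)] that(1)] by (simp add: Int_commute)
  have v: "indicat_real Z x *\<^sub>R ?v x = (\<Sum>j\<le>T. w j * indicat_real (Z \<inter> P j) x)" for Z x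
    unfolding real_scaleR_def sum_distrib_left by (intro sum.cong) (auto simp: indicator_def)
  have int: "integrable lebesgue (\<lambda>x. w j * indicat_real (Z \<inter> P j) x)"
    if "Z \<in> sets lebesgue" "j \<le> T" for Z j
    using meas[OF that] by (auto intro!: integrable_mult_right simp: fmeasurable_def)
  show ?thesis
    unfolding value_measure_on_def
  proof (intro exI[of _ ?v] conjI ballI impI)
    show "0 \<le> ?v x" for x
      using w by (intro sum_nonneg) auto
    show "set_integrable lebesgue C ?v"
      unfolding set_integrable_def v using int C by (intro Bochner_Integration.integrable_sum) auto
    fix Z :: "plane set" assume Z: "Z \<in> sets lebesgue"
    have "(LINT x:Z|lebesgue. ?v x) = (\<Sum>j\<le>T. \<integral>x. w j * indicat_real (Z \<inter> P j) x \<partial>lebesgue)"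
      unfolding set_lebesgue_integral_def v using int Z
      by (intro Bochner_Integration.integral_sum) auto
    also have "\<dots> = pooled_value P w T Z"
      unfolding pooled_value_def by simp
    finally show "pooled_value P w T Z = (LINT x:Z|lebesgue. ?v x)" by simp
  qed
qed

text \<open>
  The counting argument. A piece that meets only a pool of weight \<open>1\<close> is worth at most \<open>\<mu>\<close>, so
  \<open>n\<close> agents who all exceed \<open>\<mu>\<close> would all draw on pool \<open>0\<close>, whose total value is \<open>n * \<mu>\<close>. Convexity
  makes the frontiers of the pieces negligible, so disjoint interiors are enough for
  their measures to add up.
\<close>

lemma exists_agent_with_at_most_one_pool:
  assumes n: "n \<ge> 1"
    and P: "\<And>j. j \<le> T \<Longrightarrow> P j \<in> lmeasurable"
    and size: "\<And>j. j \<le> T \<Longrightarrow> measure lebesgue (P j) = \<mu>"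
    and Z: "\<And>i. i \<in> {1..n} \<Longrightarrow> convex (Z i) \<and> bounded (Z i)"
    and one_pool: "\<And>i j k. i \<in> {1..n} \<Longrightarrow> j < k \<Longrightarrow> k \<le> T \<Longrightarrow> Z i \<inter> P j = {} \<or> Z i \<inter> P k = {}"
    and disj: "disjoint_family_on (\<lambda>i. interior (Z i)) {1..n}"
  shows "\<exists>i\<in>{1..n}. pooled_value P (\<lambda>j. if j = 0 then real n else 1) T (Z i) \<le> \<mu>"
proof (rule ccontr)
  let ?w = "\<lambda>j::nat. if j = 0 then real n else 1"
  assume "\<not> ?thesis"
  then have big: "\<mu> < pooled_value P ?w T (Z i)" if "i \<in> {1..n}" for i
    using that by force
  have Zm: "Z i \<in> lmeasurable" if "i \<in> {1..n}" for i
    using Z[OF that] measurable_convex by blast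
  have \<mu>: "0 \<le> \<mu>"
    using size[of 0] by (metis measure_nonneg zero_le)
  \<comment> \<open>No agent can be satisfied outside pool \<open>0\<close>.\<close>
  have central: "\<mu> < n * measure lebesgue (interior (Z i) \<inter> P 0)" if i: "i \<in> {1..n}" for i
  proof -
    have single: "pooled_value P ?w T (Z i) = ?w j * measure lebesgue (Z i \<inter> P j)"
      if j: "j \<le> T" "Z i \<inter> P j \<noteq> {}" for j
    proof -
      have "Z i \<inter> P k = {}" if "k \<le> T" "k \<noteq> j" for k
        using one_pool[OF i, of k j] one_pool[OF i, of j k] that j by (metis linorder_neqE_nat)
      then have "pooled_value P ?w T (Z i) =
          (\<Sum>k\<in>{j}. ?w k * measure lebesgue (Z i \<inter> P k))"
        unfolding pooled_value_def using j by (intro sum.mono_neutral_right) auto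
      then show ?thesis by simp
    qed
    have "\<exists>j\<le>T. Z i \<inter> P j \<noteq> {}"
    proof (rule ccontr)
      assume "\<not> ?thesis"
      then have "pooled_value P ?w T (Z i) = 0"
        by (auto simp: pooled_value_def intro!: sum.neutral)
      then show False using big[OF i] \<mu> by simp
    qed
    then obtain j where j: "j \<le> T" "Z i \<inter> P j \<noteq> {}" by blast
    have "j = 0"
    proof (rule ccontr)
      assume "j \<noteq> 0"
      then have "pooled_value P ?w T (Z i) = measure lebesgue (Z i \<inter> P j)"
        using single[OF j] by simp
      also have "\<dots> \<le> measure lebesgue (P j)"
        using P[OF j(1)] Zm[OF i] by (intro measure_mono_fmeasurable) auto
      finally show False using big[OF i] size[OF j(1)] by simp
    qed
    then have "pooled_value P ?w T (Z i) = n * measure lebesgue (Z i \<inter> P 0)"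
      using single[OF j] by simp
    also have "measure lebesgue (Z i \<inter> P 0) = measure lebesgue (interior (Z i) \<inter> P 0)"
    proof (rule measure_negligible_symdiff)
      show "interior (Z i) \<inter> P 0 \<in> lmeasurable"
        using P[of 0] by (metis Int_commute fmeasurable_Int_fmeasurable lmeasurable_interior
            Z[OF i] fmeasurableD le0)
      show "negligible (sym_diff (interior (Z i) \<inter> P 0) (Z i \<inter> P 0))"
        using interior_subset[of "Z i"] closure_subset[of "Z i"]
        by (intro negligible_subset[OF negligible_convex_frontier[of "Z i"]])
          (use Z[OF i] in \<open>auto simp: frontier_def\<close>)
    qed
    finally show ?thesis using big[OF i] by simp
  qed
  have "n * \<mu> = (\<Sum>i\<in>{1..n}. \<mu>)" by simp
  also have "\<dots> < (\<Sum>i\<in>{1..n}. n * measure lebesgue (interior (Z i) \<inter> P 0))"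
    using n central by (intro sum_strict_mono) auto
  also have "\<dots> = n * measure lebesgue (\<Union>i\<in>{1..n}. interior (Z i) \<inter> P 0)"
    unfolding sum_distrib_left[symmetric]
  proof (subst measure_UNION')
    show "pairwise (\<lambda>i j. disjnt (interior (Z i) \<inter> P 0) (interior (Z j) \<inter> P 0)) {1..n}"
      using disj by (auto simp: disjoint_family_on_def pairwise_def disjnt_def)
    show "interior (Z i) \<inter> P 0 \<in> lmeasurable" if "i \<in> {1..n}" for i
      using P[of 0] by (metis Int_commute fmeasurable_Int_fmeasurable lmeasurable_interior
            Z[OF that] fmeasurableD le0)
  qed auto
  also have "\<dots> \<le> n * measure lebesgue (P 0)"
  proof (intro mult_left_mono measure_mono_fmeasurable)
    show "(\<Union>i\<in>{1..n}. interior (Z i) \<inter> P 0) \<in> sets lebesgue"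
      using P[of 0] by (intro sets.finite_UN sets.Int) (auto intro: fmeasurableD)
  qed (use P[of 0] in auto)
  finally show False using size[of 0] by simp
qed

section \<open>Angles and pools of the staircase\<close>

lemma internal_angle_origin: "internal_angle (staircase T) (0, 0) = pi / 2"
proof -
  have local: "(0, 0) + (x, y) \<in> staircase T \<longleftrightarrow> 0 \<le> x \<and> 0 \<le> y" if "\<bar>x\<bar> < 1" "\<bar>y\<bar> < 1" for x y
    using that by (auto simp: mem_staircase)
  show ?thesis
    by (rule trans[OF internal_angle_local_cone[where P = "\<lambda>x y. 0 \<le> x \<and> 0 \<le> y", OF local]
            quadrant_measures(1)])
      (auto simp: zero_le_mult_iff mult_le_0_iff)
qed

lemma internal_angle_top: "internal_angle (staircase T) (0, real T + 1) = pi / 2"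
proof -
  have local: "(0, real T + 1) + (x, y) \<in> staircase T \<longleftrightarrow> 0 \<le> x \<and> y \<le> 0"
    if "\<bar>x\<bar> < 1" "\<bar>y\<bar> < 1" for x y
    using that by (auto simp: mem_staircase)
  show ?thesis
    by (rule trans[OF internal_angle_local_cone[where P = "\<lambda>x y. 0 \<le> x \<and> y \<le> 0", OF local]
            quadrant_measures(4)])
      (auto simp: zero_le_mult_iff mult_le_0_iff)
qed

lemma internal_angle_right: "internal_angle (staircase T) (real T + 1, 0) = pi / 2"
proof -
  have local: "(real T + 1, 0) + (x, y) \<in> staircase T \<longleftrightarrow> x \<le> 0 \<and> 0 \<le> y"
    if "\<bar>x\<bar> < 1" "\<bar>y\<bar> < 1" for x y
    using that by (auto simp: mem_staircase)
  show ?thesis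
    by (rule trans[OF internal_angle_local_cone[where P = "\<lambda>x y. x \<le> 0 \<and> 0 \<le> y", OF local]
            quadrant_measures(2)])
      (auto simp: zero_le_mult_iff mult_le_0_iff)
qed

text \<open>
  Near the corner of step \<open>k\<close> no other step matters: for a point in the rectangle of step \<open>j \<noteq> k\<close>
  but not in that of step \<open>k\<close>, one coordinate of the displacement would be \<open>- \<bar>j - k\<bar>\<close> or less.
\<close>

lemma internal_angle_convex_corner:
  assumes "k \<le> T"
  shows "internal_angle (staircase T) (real k + 1, real T + 1 - real k) = pi / 2"
proof -
  have local: "(real k + 1, real T + 1 - real k) + (x, y) \<in> staircase T \<longleftrightarrow> x \<le> 0 \<and> y \<le> 0"
    if "\<bar>x\<bar> < 1" "\<bar>y\<bar> < 1" for x y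
  proof
    assume "(real k + 1, real T + 1 - real k) + (x, y) \<in> staircase T"
    then obtain j where
      "real k + 1 + x \<le> real j + 1" "real T + 1 - real k + y \<le> real T + 1 - real j"
      unfolding add_Pair mem_staircase by blast
    then have j: "x \<le> real j - real k" "y \<le> real k - real j" by auto
    have "j = k"
      using j that by linarith
    then show "x \<le> 0 \<and> y \<le> 0" using j by simp
  next
    assume "x \<le> 0 \<and> y \<le> 0"
    then show "(real k + 1, real T + 1 - real k) + (x, y) \<in> staircase T"
      using assms that by (auto simp: mem_staircase intro!: exI[of _ k])
  qed
  show ?thesis
    by (rule trans[OF internal_angle_local_cone[where P = "\<lambda>x y. x \<le> 0 \<and> y \<le> 0", OF local]
            quadrant_measures(3)])
      (auto simp: zero_le_mult_iff mult_le_0_iff)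
qed

lemma internal_angle_reflex_corner:
  assumes "k < T"
  shows "internal_angle (staircase T) (real k + 1, real T - real k) = 3 * pi / 2"
proof -
  have local: "(real k + 1, real T - real k) + (x, y) \<in> staircase T \<longleftrightarrow> x \<le> 0 \<or> y \<le> 0"
    if xy: "\<bar>x\<bar> < 1" "\<bar>y\<bar> < 1" for x y
  proof
    assume "(real k + 1, real T - real k) + (x, y) \<in> staircase T"
    then obtain j where
      "real k + 1 + x \<le> real j + 1" "real T - real k + y \<le> real T + 1 - real j"
      unfolding add_Pair mem_staircase by blast
    then have "x \<le> real j - real k" "y \<le> real k + 1 - real j" by auto
    then show "x \<le> 0 \<or> y \<le> 0"
      by (cases "j \<le> k") auto
  next
    have "0 \<le> real k + 1 + x" "0 \<le> real T - real k + y"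
      using assms xy by linarith+
    moreover assume "x \<le> 0 \<or> y \<le> 0"
    then have "\<exists>j\<le>T. x \<le> real j - real k \<and> y \<le> real k + 1 - real j"
    proof
      assume "x \<le> 0" then show ?thesis using assms xy by (intro exI[of _ k]) auto
    next
      assume "y \<le> 0" then show ?thesis using assms xy by (intro exI[of _ "Suc k"]) auto
    qed
    ultimately show "(real k + 1, real T - real k) + (x, y) \<in> staircase T"
      by (auto simp: mem_staircase algebra_simps)
  qed
  show ?thesis
    by (rule trans[OF internal_angle_local_cone[where P = "\<lambda>x y. x \<le> 0 \<or> y \<le> 0", OF local]
            quadrant_measures(5)])
      (auto simp: zero_le_mult_iff mult_le_0_iff)
qed

definition reflex_corners :: "nat \<Rightarrow> plane set" where
  "reflex_corners T = (\<lambda>k. (real k + 1, real T - real k)) ` {..<T}"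

lemma set_staircase_vertices:
  "set (staircase_vertices T) =
     {(0, 0), (0, real T + 1), (real T + 1, 0)} \<union>
     (\<lambda>k. (real k + 1, real T + 1 - real k)) ` {..T} \<union> reflex_corners T"
proof -
  have "(\<lambda>k. (0 + real k + 1, real (Suc T) - real k - 1)) ` {..<Suc T} =
      insert (real T + 1, 0) (reflex_corners T)"
    unfolding reflex_corners_def lessThan_Suc by auto
  moreover have "(\<lambda>k. (0 + real k + 1, real (Suc T) - real k)) ` {..<Suc T} =
      (\<lambda>k. (real k + 1, real T + 1 - real k)) ` {..T}"
    by (simp add: lessThan_Suc_atMost algebra_simps)
  ultimately show ?thesis
    unfolding staircase_vertices_def list.set set_descent by (auto simp: add.commute)
qed

lemma internal_angle_staircase:
  assumes "p \<in> set (staircase_vertices T)"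
  shows "internal_angle (staircase T) p = (if p \<in> reflex_corners T then 3 * pi / 2 else pi / 2)"
proof (cases "p \<in> reflex_corners T")
  case True
  then show ?thesis
    by (auto simp: reflex_corners_def internal_angle_reflex_corner)
next
  case False
  then show ?thesis
    using assms by (auto simp: set_staircase_vertices internal_angle_origin internal_angle_top
        internal_angle_right internal_angle_convex_corner)
qed

lemma rectilinear_polygon_staircase: "rectilinear_polygon (staircase_vertices T) (staircase T)"
  unfolding rectilinear_polygon_def by (simp add: polygon_staircase internal_angle_staircase)

lemma card_reflex_vertices_staircase:
  "card (reflex_vertices (staircase_vertices T) (staircase T)) = T"
proof -
  have "reflex_vertices (staircase_vertices T) (staircase T) = reflex_corners T"
    unfolding reflex_vertices_def
    by (auto simp: internal_angle_staircase set_staircase_vertices split: if_splits)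
  moreover have "card (reflex_corners T) = T"
    unfolding reflex_corners_def by (subst card_image) (auto simp: inj_on_def)
  ultimately show ?thesis by simp
qed

text \<open>
  The side \<open>1/4\<close> is small enough that every point of a pool satisfies \<open>x + y \<ge> T + 3/2\<close>, well above
  the line \<open>x + y = T + 1\<close> of the reflex corners.
\<close>

definition pool :: "nat \<Rightarrow> nat \<Rightarrow> plane set" where
  "pool T j = cbox (real j + 3/4, real T + 3/4 - real j) (real j + 1, real T + 1 - real j)"

lemma mem_pool:
  "(x, y) \<in> pool T j \<longleftrightarrow> x \<in> {real j + 3/4..real j + 1} \<and>
     y \<in> {real T + 3/4 - real j..real T + 1 - real j}"
  by (auto simp: pool_def)

lemma measure_pool: "measure lebesgue (pool T j) = 1 / 16"
proof -
  have "measure lebesgue (pool T j) = measure lborel (pool T j)"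
    unfolding pool_def by (simp add: measure_completion)
  then show ?thesis
    by (simp add: pool_def content_Pair)
qed

lemma pool_subset_staircase: "j \<le> T \<Longrightarrow> pool T j \<subseteq> staircase T"
  by (force simp: mem_pool mem_staircase)

text \<open>
  A segment from pool \<open>j\<close> to a later pool crosses the vertical line \<open>x = j + 5/4\<close>, which is to the
  right of step \<open>j\<close>, where the staircase has height at most \<open>T - j\<close>. On the segment
  \<open>x + y \<ge> T + 3/2\<close>, so the crossing is at height at least \<open>T - j + 1/4\<close>, outside the staircase.
\<close>

lemma convex_subset_staircase_one_pool:
  assumes Z: "convex Z" "Z \<subseteq> staircase T" and jk: "j < k"
  shows "Z \<inter> pool T j = {} \<or> Z \<inter> pool T k = {}"
proof (rule ccontr)
  assume "\<not> ?thesis"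
  then obtain a b c d where p: "(a, b) \<in> Z" "(a, b) \<in> pool T j"
    and q: "(c, d) \<in> Z" "(c, d) \<in> pool T k"
    by fast
  have a: "a \<le> real j + 1" "a + b \<ge> real T + 3/2" and c: "c \<ge> real j + 7/4" "c + d \<ge> real T + 3/2"
    using p(2) q(2) jk by (auto simp: mem_pool)
  define x where "x = real j + 5/4"
  define u where "u = (x - a) / (c - a)"
  define y where "y = (1 - u) * b + u * d"
  have u: "0 \<le> u" "u \<le> 1"
    using a c by (auto simp: u_def x_def divide_simps)
  have "u * (c - a) = x - a"
    using a c by (simp add: u_def)
  then have x: "x = (1 - u) * a + u * c"
    by (simp add: algebra_simps)
  have "(1 - u) *\<^sub>R (a, b) + u *\<^sub>R (c, d) \<in> Z"
    using Z(1) p(1) q(1) u unfolding convex_alt by blast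
  then have "(x, y) \<in> staircase T"
    using Z(2) by (auto simp: x y_def)
  then obtain i where "x \<le> real i + 1" "y \<le> real T + 1 - real i"
    by (auto simp: mem_staircase)
  moreover from this(1) have "i \<ge> Suc j"
    unfolding x_def by linarith
  moreover have "x + y \<ge> real T + 3/2"
  proof -
    have "real T + 3/2 = (1 - u) * (real T + 3/2) + u * (real T + 3/2)"
      by (simp only: distrib_right[symmetric]) simp
    also have "\<dots> \<le> (1 - u) * (a + b) + u * (c + d)"
      using u a c by (intro add_mono[OF mult_left_mono mult_left_mono]) simp_all
    also have "\<dots> = x + y"
      unfolding y_def x by (simp add: algebra_simps)
    finally show ?thesis .
  qed
  ultimately show False
    unfolding x_def by linarith
qed

theorem proposition7p2:
  fixes n T :: nat
  assumes "n \<ge> 1"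
  shows "\<exists>ps C. rectilinear_polygon ps C \<and> card (reflex_vertices ps C) = T \<and>
    (\<exists>V :: nat \<Rightarrow> plane set \<Rightarrow> real.
      (\<forall>i\<in>{1..n}. value_measure_on C (V i) \<and> V i C > 0) \<and>
      (\<forall>Z :: nat \<Rightarrow> plane set.
        (\<forall>i\<in>{1..n}. rectangle (Z i) \<and> Z i \<subseteq> C) \<and>
        disjoint_family_on (\<lambda>i. interior (Z i)) {1..n} \<longrightarrow>
        (\<exists>i\<in>{1..n}. V i (Z i) \<le> 1 / real (n + T) * V i C)))"
proof -
  let ?C = "staircase T"
  let ?w = "\<lambda>j::nat. if j = 0 then real n else 1"
  let ?V = "pooled_value (pool T) ?w T"
  have pool: "pool T j \<in> lmeasurable" for j
    by (simp add: pool_def)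
  have total: "?V ?C = real (n + T) / 16"
  proof -
    have "?V ?C = (\<Sum>j\<le>T. ?w j / 16)"
      unfolding pooled_value_def
      by (intro sum.cong) (auto simp: pool_subset_staircase Int_absorb1 measure_pool)
    then show ?thesis
      unfolding sum.atMost_shift by simp
  qed
  have "value_measure_on ?C ?V"
    using pool compact_imp_closed[OF compact_staircase]
    by (intro value_measure_pooled_value) (auto intro: lebesgue_closedin)
  moreover have "\<exists>i\<in>{1..n}. ?V (Z i) \<le> 1 / real (n + T) * ?V ?C"
    if Z: "\<And>i. i \<in> {1..n} \<Longrightarrow> rectangle (Z i) \<and> Z i \<subseteq> ?C"
      and disj: "disjoint_family_on (\<lambda>i. interior (Z i)) {1..n}" for Z :: "nat \<Rightarrow> plane set"
  proof -
    have "\<exists>i\<in>{1..n}. ?V (Z i) \<le> 1 / 16"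
    proof (rule exists_agent_with_at_most_one_pool[OF assms pool measure_pool _ _ disj])
      show "convex (Z i) \<and> bounded (Z i)" if "i \<in> {1..n}" for i
        using Z[OF that] convex_rectangle compact_imp_bounded[OF compact_staircase] bounded_subset
        by blast
      show "Z i \<inter> pool T j = {} \<or> Z i \<inter> pool T k = {}" if "i \<in> {1..n}" "j < k" for i j k
        using Z[OF that(1)] convex_rectangle convex_subset_staircase_one_pool that(2) by blast
    qed
    then show ?thesis
      using assms by (simp add: total)
  qed
  moreover have "?V ?C > 0"
    using assms by (simp add: total)
  ultimately show ?thesis
    by (intro exI[of _ "staircase_vertices T"] exI[of _ ?C] exI[of _ "\<lambda>_. ?V"] conjI
        rectilinear_polygon_staircase card_reflex_vertices_staircase) blast+
qed

end
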